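(* Let $r \ge 1$ be a fixed integer and $n > r$. Consider the Markov chain $(H_t)_{t \ge 1}$ on the $r$-element subsets of $[n] = \{1,\ldots,n\}$ in which $H_1$ is uniformly random and, given $H_t$, $H_{t+1}$ is obtained by choosing a uniformly random element of $H_t$ and replacing it with a uniformly random element of $[n] \setminus H_t$. Let $T^{(r,r)}_{\mathrm{RW}}$ be the smallest $k$ such that every $r$-element subset of $[n]$ equals $H_t$ for some $t \le k$. Then, as $n \to \infty$, \[ \mathbb{E}\, T^{(r,r)}_{\mathrm{RW}} = \binom{n}{r}\log\binom{n}{r}\,(1+o(1)). \] *)

theory Defs
  imports "HOL-Probability.Probability" "HOL-Library.Landau_Symbols"
begin

definition r_subsets :: "nat \<Rightarrow> nat \<Rightarrow> nat set set" where
  "r_subsets n r = {A. A \<subseteq> {1..n} \<and> card A = r}"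

definition rw_step :: "nat \<Rightarrow> nat set \<Rightarrow> nat set pmf" where
  "rw_step n H = bind_pmf (pmf_of_set H)
     (\<lambda>x. map_pmf (\<lambda>y. insert y (H - {x})) (pmf_of_set ({1..n} - H)))"

fun rw_paths :: "nat \<Rightarrow> nat \<Rightarrow> nat \<Rightarrow> nat set list pmf" where
  "rw_paths n r 0 = return_pmf []"
| "rw_paths n r (Suc 0) = map_pmf (\<lambda>H. [H]) (pmf_of_set (r_subsets n r))"
| "rw_paths n r (Suc (Suc k)) =
     bind_pmf (rw_paths n r (Suc k)) (\<lambda>xs. map_pmf (\<lambda>H. xs @ [H]) (rw_step n (last xs)))"

definition cover_prob :: "nat \<Rightarrow> nat \<Rightarrow> nat \<Rightarrow> real" where
  "cover_prob n r k = measure_pmf.prob (rw_paths n r k) {xs. r_subsets n r \<subseteq> set xs}"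

text \<open>Expectation of the cover time T (an extended natural): sum of k P(T = k),
  plus infinity if T = \<infinity> with positive probability.\<close>
definition expected_cover_time :: "nat \<Rightarrow> nat \<Rightarrow> ennreal" where
  "expected_cover_time n r =
     (\<Sum>k. of_nat k * ennreal (cover_prob n r k - cover_prob n r (k - 1)))
     + (if (SUP k. cover_prob n r k) < 1 then \<infinity> else 0)"

end

theory Submission
  imports Defs "HOL-Analysis.Harmonic_Numbers" "HOL-Real_Asymp.Real_Asymp"
begin

text \<open>
  The proof is Matthews' method. If all expected hitting times between distinct states lie in
  \<open>[l, h]\<close>, then the expected time to visit \<open>k\<close> further states lies between \<open>l\<close> and \<open>h\<close> times the
  \<open>k\<close>-th harmonic number. For a set \<open>B\<close> of unvisited states, consider
  \<open>|B| C(x, B) - (\<Sum>y\<in>B. C(x, B - {y}))\<close> with \<open>C\<close> the expected cover time. As long as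
  \<open>|B| \<ge> 2\<close>, one step of the chain preserves this quantity on average, and for \<open>|B| = 1\<close> it is a
  hitting time; hence it lies in \<open>[l, h]\<close>, and the bounds follow by induction on \<open>|B|\<close>.

  On the \<open>r\<close>-subsets the distance to a fixed target is a birth-death chain. With \<open>N = n choose r\<close>,
  passing from distance 1 to 0 takes exactly \<open>N - 1\<close> steps on average, and from \<open>d \<ge> 2\<close> to \<open>d - 1\<close>
  only \<open>O(N / n)\<close>, so one can take \<open>l = N - 1\<close> and \<open>h = N (1 + O(1 / n))\<close>.
\<close>

section \<open>Matthews' upper bound for a general finite chain\<close>

lemma mult_harm_Suc:
  "real (Suc k) * (c * harm (Suc k)) = real (Suc k) * (c * harm k) + c"
  by (simp add: harm_Suc field_simps del: of_nat_Suc)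

lemma Diff_singleton_nonempty: "finite B \<Longrightarrow> card B \<ge> 2 \<Longrightarrow> B - {y} \<noteq> {}"
  by (auto simp: subset_singleton_iff)

lemma card_less_2_cases:
  assumes "finite B" obtains "B = {}" | y where "B = {y}" | "card B \<ge> 2"
  using assms by (metis One_nat_def Suc_1 card_1_singletonE card_eq_0_iff le_antisym not_less_eq_eq le0)

locale finite_chain =
  fixes K :: "'a \<Rightarrow> 'a pmf" and S :: "'a set"
  assumes finite_S: "finite S"
    and closed: "x \<in> S \<Longrightarrow> set_pmf (K x) \<subseteq> S"
begin

text \<open>The probability that the chain started in \<open>x\<close> does not visit all of \<open>B\<close> at times \<open>1, \<dots>, t\<close>;
  the starting point itself does not count as visited.\<close>

primrec miss_prob :: "nat \<Rightarrow> 'a \<Rightarrow> 'a set \<Rightarrow> real" where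
  "miss_prob 0 x B = (if B = {} then 0 else 1)"
| "miss_prob (Suc t) x B = measure_pmf.expectation (K x) (\<lambda>y. miss_prob t y (B - {y}))"

definition trunc_cover_time :: "nat \<Rightarrow> 'a \<Rightarrow> 'a set \<Rightarrow> real" where
  "trunc_cover_time t x B = (\<Sum>s<t. miss_prob s x B)"

text \<open>As \<open>t\<close> tends to infinity this becomes the expectation of the hitting time of the last visited
  point of \<open>B\<close> from the last but one.  Working with the algebraic expression instead avoids stopping
  times and random orderings.\<close>

definition excess :: "nat \<Rightarrow> 'a \<Rightarrow> 'a set \<Rightarrow> real" where
  "excess t x B = real (card B) * trunc_cover_time t x B - (\<Sum>y\<in>B. trunc_cover_time t x (B - {y}))"

lemma expectation_eq_sum:
  assumes "x \<in> S"
  shows "measure_pmf.expectation (K x) f = (\<Sum>y\<in>S. pmf (K x) y * f y)"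
  by (subst integral_measure_pmf[OF finite_S]) (use closed[OF assms] in auto)

lemma sum_pmf_S: "x \<in> S \<Longrightarrow> (\<Sum>y\<in>S. pmf (K x) y) = 1"
  by (rule sum_pmf_eq_1[OF finite_S closed])

lemma miss_prob_Suc:
  "x \<in> S \<Longrightarrow> miss_prob (Suc t) x B = (\<Sum>y\<in>S. pmf (K x) y * miss_prob t y (B - {y}))"
  by (simp add: expectation_eq_sum)

declare miss_prob.simps(2) [simp del]

lemma miss_prob_empty [simp]: "miss_prob t x {} = 0"
  by (induction t arbitrary: x) (simp_all add: miss_prob.simps(2))

lemma average_mono:
  assumes "x \<in> S" "\<And>y. y \<in> S \<Longrightarrow> f y \<le> g y"
  shows "(\<Sum>y\<in>S. pmf (K x) y * f y) \<le> (\<Sum>y\<in>S. pmf (K x) y * (g y :: real))"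
  by (intro sum_mono mult_left_mono assms) auto

lemma average_const: "x \<in> S \<Longrightarrow> (\<Sum>y\<in>S. pmf (K x) y * c) = c"
  by (simp add: sum_pmf_S flip: sum_distrib_right)

lemma average_le:
  assumes "x \<in> S" "\<And>y. y \<in> S \<Longrightarrow> f y \<le> c"
  shows "(\<Sum>y\<in>S. pmf (K x) y * f y) \<le> (c :: real)"
  using average_mono[of x f "\<lambda>_. c"] assms average_const[of x c] by simp

lemma miss_prob_nonneg: "x \<in> S \<Longrightarrow> miss_prob t x B \<ge> 0"
  by (induction t arbitrary: x B) (auto simp: miss_prob_Suc intro!: sum_nonneg mult_nonneg_nonneg)

lemma miss_prob_le_1: "x \<in> S \<Longrightarrow> miss_prob t x B \<le> 1"
  by (induction t arbitrary: x B) (auto simp: miss_prob_Suc intro!: average_le)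

lemma miss_prob_Suc_le: "x \<in> S \<Longrightarrow> miss_prob (Suc t) x B \<le> miss_prob t x B"
proof (induction t arbitrary: x B)
  case 0
  then show ?case using miss_prob_le_1[of x "Suc 0" B] by (cases "B = {}") auto
next
  case (Suc t)
  then show ?case by (auto simp: miss_prob_Suc[of x] intro!: average_mono)
qed

lemma trunc_cover_time_0 [simp]: "trunc_cover_time 0 x B = 0"
  and trunc_cover_time_empty [simp]: "trunc_cover_time t x {} = 0"
  by (simp_all add: trunc_cover_time_def)

lemma trunc_cover_time_nonneg: "x \<in> S \<Longrightarrow> trunc_cover_time t x B \<ge> 0"
  by (auto simp: trunc_cover_time_def miss_prob_nonneg intro: sum_nonneg)

lemma trunc_cover_time_Suc:
  assumes "x \<in> S" "B \<noteq> {}"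
  shows "trunc_cover_time (Suc t) x B = 1 + (\<Sum>y\<in>S. pmf (K x) y * trunc_cover_time t y (B - {y}))"
proof -
  have "trunc_cover_time (Suc t) x B = 1 + (\<Sum>s<t. miss_prob (Suc s) x B)"
    unfolding trunc_cover_time_def sum.lessThan_Suc_shift using assms by simp
  also have "(\<Sum>s<t. miss_prob (Suc s) x B) = (\<Sum>s<t. \<Sum>y\<in>S. pmf (K x) y * miss_prob s y (B - {y}))"
    by (simp add: miss_prob_Suc assms)
  also have "\<dots> = (\<Sum>y\<in>S. pmf (K x) y * trunc_cover_time t y (B - {y}))"
    by (subst sum.swap) (simp add: trunc_cover_time_def sum_distrib_left)
  finally show ?thesis .
qed

lemma excess_0 [simp]: "excess 0 x B = 0"
  by (simp add: excess_def)

lemma excess_singleton [simp]: "excess t x {y} = trunc_cover_time t x {y}"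
  by (simp add: excess_def)

text \<open>With \<open>card B >= 2\<close> every \<open>B - {y}\<close> is nonempty, so each cover
  time contributes the constant 1 of its one-step equation. There are \<open>card B\<close> of these
  on either side of the difference, and they cancel.\<close>

lemma excess_Suc:
  assumes "x \<in> S" "finite B" "card B \<ge> 2"
  shows "excess (Suc t) x B = (\<Sum>z\<in>S. pmf (K x) z * excess t z (B - {z}))"
proof -
  have ne: "B \<noteq> {}" and ne': "B - {y} \<noteq> {}" for y
    using assms(3) Diff_singleton_nonempty[OF assms(2,3)] by auto
  \<comment> \<open>If the step lands on some \<open>z\<close> in \<open>B\<close>, the summand
    \<open>y = z\<close> absorbs one of the \<open>card B\<close> copies, which leaves the weight
    \<open>card (B - {z})\<close> that the excess of the smaller set requires.\<close>
  have *: "real (card B) * trunc_cover_time t z (B - {z}) - (\<Sum>y\<in>B. trunc_cover_time t z (B - {y} - {z}))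
      = excess t z (B - {z})" for z
  proof (cases "z \<in> B")
    case True
    have "real (card B) = real (card (B - {z})) + 1"
      using True assms by (simp add: card_Diff_singleton)
    moreover have "(\<Sum>y\<in>B. trunc_cover_time t z (B - {y} - {z}))
        = trunc_cover_time t z (B - {z}) + (\<Sum>y\<in>B - {z}. trunc_cover_time t z (B - {z} - {y}))"
      using True assms by (simp add: sum.remove[of B z] Diff_insert2[symmetric] insert_commute)
    ultimately show ?thesis by (simp add: excess_def algebra_simps)
  next
    case False
    then have "B - {y} - {z} = B - {y}" for y by auto
    with False show ?thesis by (simp add: excess_def)
  qed
  have "excess (Suc t) x B
      = real (card B) * (\<Sum>z\<in>S. pmf (K x) z * trunc_cover_time t z (B - {z}))
        - (\<Sum>y\<in>B. \<Sum>z\<in>S. pmf (K x) z * trunc_cover_time t z (B - {y} - {z}))"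
    using assms ne ne' by (simp add: excess_def trunc_cover_time_Suc sum.distrib algebra_simps)
  also have "\<dots> = (\<Sum>z\<in>S. pmf (K x) z * (real (card B) * trunc_cover_time t z (B - {z})
        - (\<Sum>y\<in>B. trunc_cover_time t z (B - {y} - {z}))))"
    by (subst sum.swap)
      (simp add: sum_distrib_left sum_subtractf right_diff_distrib mult.left_commute)
  finally show ?thesis by (simp only: *)
qed

text \<open>In the limit this becomes the base case of the lower bound in
  \<open>excess_ge\<close>.\<close>

lemma excess_nonneg:
  assumes "x \<in> S" "finite B"
  shows "excess t x B \<ge> 0"
  using assms
proof (induction t arbitrary: x B)
  case (Suc t)
  from \<open>finite B\<close> show ?case
  proof (cases rule: card_less_2_cases)
    case 1
    then show ?thesis by (simp add: excess_def)
  next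
    case (2 y)
    then show ?thesis using Suc by (simp add: trunc_cover_time_nonneg)
  next
    case 3
    then show ?thesis using Suc
      by (auto simp: excess_Suc intro!: sum_nonneg mult_nonneg_nonneg)
  qed
qed simp

text \<open>By \<open>excess_Suc\<close> the excess is an average of earlier excesses until one
  target is left, where it is a truncated hitting time. The condition that the current state lies
  outside the target set survives each step, since the state reached is removed from the
  set.\<close>

lemma excess_le:
  assumes hit: "\<And>t x y. x \<in> S \<Longrightarrow> y \<in> S \<Longrightarrow> x \<noteq> y \<Longrightarrow> trunc_cover_time t x {y} \<le> h" and h: "h \<ge> 0"
  assumes "x \<in> S" "B \<subseteq> S" "x \<notin> B"
  shows "excess t x B \<le> h"
  using assms(3-)
proof (induction t arbitrary: x B)
  case 0
  then show ?case by (simp add: h)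
next
  case (Suc t)
  have "finite B" using Suc finite_S finite_subset by blast
  then show ?case
  proof (cases rule: card_less_2_cases)
    case 1
    then show ?thesis by (simp add: excess_def h)
  next
    case (2 y)
    then show ?thesis using Suc hit by auto
  next
    case 3
    have "excess t z (B - {z}) \<le> h" if "z \<in> S" for z
      using Suc that by blast
    then show ?thesis using Suc.prems 3 \<open>finite B\<close>
      by (simp add: excess_Suc average_le)
  qed
qed

text \<open>With \<open>k + 1\<close> targets, \<open>excess_le\<close> reads: \<open>k + 1\<close>
  times the cover time is at most \<open>h\<close> plus the sum of the cover times with one target
  removed. By induction each of these is at most \<open>h * harm k\<close>; dividing by
  \<open>k + 1\<close> adds the next harmonic term.\<close>

theorem matthews_upper:
  assumes hit: "\<And>t x y. x \<in> S \<Longrightarrow> y \<in> S \<Longrightarrow> x \<noteq> y \<Longrightarrow> trunc_cover_time t x {y} \<le> h" and h: "h \<ge> 0"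
  assumes "x \<in> S" "B \<subseteq> S" "x \<notin> B"
  shows "trunc_cover_time t x B \<le> h * harm (card B)"
  using assms(3-)
proof (induction "card B" arbitrary: B)
  case 0
  have "finite B" using 0 finite_S finite_subset by blast
  with 0 show ?case by (simp add: harm_def)
next
  case (Suc k)
  have fin: "finite B" using Suc finite_S finite_subset by blast
  have "trunc_cover_time t x (B - {y}) \<le> h * harm k" if "y \<in> B" for y
  proof -
    have "card (B - {y}) = k" using that Suc.hyps(2) fin by simp
    then show ?thesis using Suc.hyps(1)[of "B - {y}"] Suc.prems by auto
  qed
  then have "(\<Sum>y\<in>B. trunc_cover_time t x (B - {y})) \<le> real (Suc k) * (h * harm k)"
    using sum_bounded_above[of B "\<lambda>y. trunc_cover_time t x (B - {y})" "h * harm k"] Suc.hyps(2) by simp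
  moreover have "excess t x B \<le> h"
    by (rule excess_le[OF hit h]) (use Suc in auto)
  ultimately have "real (Suc k) * trunc_cover_time t x B \<le> real (Suc k) * (h * harm (Suc k))"
    unfolding mult_harm_Suc by (simp add: excess_def Suc.hyps(2)[symmetric] algebra_simps)
  then show ?case using Suc.hyps(2) by simp
qed

section \<open>Limits of truncated times and Matthews' lower bound\<close>

text \<open>As a real series this is the expected cover time only where it converges; convergence is
  always derived from a bound on the truncated times that is uniform in \<open>t\<close>.\<close>

definition cover_time :: "'a \<Rightarrow> 'a set \<Rightarrow> real" where
  "cover_time x B = (\<Sum>t. miss_prob t x B)"

lemma summable_miss_prob:
  assumes "x \<in> S" "\<And>t. trunc_cover_time t x B \<le> C"
  shows "summable (\<lambda>t. miss_prob t x B)"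
  by (rule summableI_nonneg_bounded[of _ C]) (use assms in \<open>auto simp: miss_prob_nonneg trunc_cover_time_def\<close>)

lemma trunc_cover_time_tendsto_cover_time:
  assumes "x \<in> S" "\<And>t. trunc_cover_time t x B \<le> C"
  shows "(\<lambda>t. trunc_cover_time t x B) \<longlonglongrightarrow> cover_time x B"
  using summable_LIMSEQ[OF summable_miss_prob[OF assms]] by (simp add: trunc_cover_time_def cover_time_def)

lemma miss_prob_tendsto_0:
  assumes "x \<in> S" "\<And>t. trunc_cover_time t x B \<le> C"
  shows "(\<lambda>t. miss_prob t x B) \<longlonglongrightarrow> 0"
  by (rule summable_LIMSEQ_zero[OF summable_miss_prob[OF assms]])

lemma tendsto_ge_of_miss_prob:
  assumes "x \<in> S" "\<And>t. trunc_cover_time t x B \<le> C" "\<And>t. a - b * miss_prob t x B \<le> f t" "f \<longlonglongrightarrow> c"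
  shows "a \<le> c"
proof (rule LIMSEQ_le[OF _ assms(4)])
  show "(\<lambda>t. a - b * miss_prob t x B) \<longlonglongrightarrow> a"
    using tendsto_diff[OF tendsto_const tendsto_mult[OF tendsto_const miss_prob_tendsto_0[OF assms(1,2)]],
      of a b] by simp
qed (use assms(3) in auto)

text \<open>A truncated excess starts at 0, so it has no positive lower bound uniform in
  \<open>t\<close>. The limiting excess \<open>ex\<close> satisfies the same averaging equation
  exactly. Unrolling it for \<open>t\<close> steps gives at least \<open>l\<close> on the paths that
  have covered \<open>B\<close>, because these passed through a single remaining target; the other
  paths cost at most \<open>l\<close> times their probability, as \<open>ex\<close> is
  nonnegative.\<close>

lemma excess_ge:
  assumes lim_cover: "\<And>x B. x \<in> S \<Longrightarrow> B \<subseteq> S \<Longrightarrow> x \<notin> B \<Longrightarrow> (\<lambda>t. trunc_cover_time t x B) \<longlonglongrightarrow> cover_time x B"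
    and hit: "\<And>x y. x \<in> S \<Longrightarrow> y \<in> S \<Longrightarrow> x \<noteq> y \<Longrightarrow> l \<le> cover_time x {y}" and l: "l \<ge> 0"
  assumes "x \<in> S" "B \<subseteq> S" "x \<notin> B" "B \<noteq> {}"
  defines "ex \<equiv> (\<lambda>x B. real (card B) * cover_time x B - (\<Sum>y\<in>B. cover_time x (B - {y})))"
  shows "l - l * miss_prob t x B \<le> ex x B"
proof -
  have lim: "(\<lambda>t. excess t x B) \<longlonglongrightarrow> ex x B" if "x \<in> S" "B \<subseteq> S" "x \<notin> B" for x B
    unfolding excess_def ex_def using that by (intro tendsto_intros lim_cover) auto
  have ex_nonneg: "ex x B \<ge> 0" if "x \<in> S" "B \<subseteq> S" "x \<notin> B" for x B
    by (rule LIMSEQ_le_const[OF lim]) (use that finite_S in \<open>auto intro!: excess_nonneg dest: finite_subset\<close>)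
  from assms(4-7) show ?thesis
  proof (induction t arbitrary: x B)
    case 0
    then show ?case using ex_nonneg by simp
  next
    case (Suc t)
    have "finite B" using Suc finite_S finite_subset by blast
    then show ?case
    proof (cases rule: card_less_2_cases)
      case 1
      then show ?thesis using Suc by simp
    next
      case (2 y)
      have "ex x B = cover_time x {y}" using 2 by (simp add: ex_def cover_time_def)
      moreover have "0 \<le> l * miss_prob (Suc t) x B" using Suc by (intro mult_nonneg_nonneg l miss_prob_nonneg)
      ultimately show ?thesis using 2 Suc hit[of x y] by auto
    next
      case 3
      have ne: "B - {y} \<noteq> {}" for y
        using 3 \<open>finite B\<close> by (intro Diff_singleton_nonempty)
      have "(\<lambda>s. \<Sum>z\<in>S. pmf (K x) z * excess s z (B - {z}))
          \<longlonglongrightarrow> (\<Sum>z\<in>S. pmf (K x) z * ex z (B - {z}))"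
        using Suc by (intro tendsto_intros lim) auto
      moreover have "(\<lambda>s. excess (Suc s) x B) \<longlonglongrightarrow> ex x B"
        using lim Suc by (intro LIMSEQ_Suc) auto
      ultimately have "ex x B = (\<Sum>z\<in>S. pmf (K x) z * ex z (B - {z}))"
        using Suc 3 \<open>finite B\<close> by (simp add: excess_Suc LIMSEQ_unique)
      also have "\<dots> \<ge> (\<Sum>z\<in>S. pmf (K x) z * (l - l * miss_prob t z (B - {z})))"
      proof (rule average_mono)
        show "l - l * miss_prob t z (B - {z}) \<le> ex z (B - {z})" if "z \<in> S" for z
          using Suc.IH[of z "B - {z}"] Suc.prems that ne by blast
      qed (use Suc in auto)
      also have "(\<Sum>z\<in>S. pmf (K x) z * (l - l * miss_prob t z (B - {z}))) = l - l * miss_prob (Suc t) x B"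
        using Suc average_const[of x l]
        by (simp add: miss_prob_Suc right_diff_distrib sum_subtractf sum_distrib_left mult.left_commute)
      finally show ?thesis .
    qed
  qed
qed

text \<open>The upper bound \<open>h\<close> makes all cover times finite, so that the limits exist
  and the error \<open>l * miss_prob\<close> in \<open>excess_ge\<close> vanishes. The induction
  then mirrors \<open>matthews_upper\<close> with the inequalities reversed.\<close>

theorem matthews_lower:
  assumes hit: "\<And>t x y. x \<in> S \<Longrightarrow> y \<in> S \<Longrightarrow> x \<noteq> y \<Longrightarrow> trunc_cover_time t x {y} \<le> h" and h: "h \<ge> 0"
    and low: "\<And>x y. x \<in> S \<Longrightarrow> y \<in> S \<Longrightarrow> x \<noteq> y \<Longrightarrow> l \<le> cover_time x {y}" and l: "l \<ge> 0"
  assumes "x \<in> S" "B \<subseteq> S" "x \<notin> B"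
  shows "l * harm (card B) \<le> cover_time x B"
  using assms(5-)
proof (induction "card B" arbitrary: B)
  case 0
  have "finite B" using 0 finite_S finite_subset by blast
  with 0 show ?case by (simp add: harm_def cover_time_def)
next
  case (Suc k)
  have fin: "finite B" using Suc finite_S finite_subset by blast
  have ne: "B \<noteq> {}" using Suc by auto
  have bound: "trunc_cover_time t x B \<le> h * harm (card B)" if "x \<in> S" "B \<subseteq> S" "x \<notin> B" for x B t
    using matthews_upper[OF hit h that] .
  have lim: "(\<lambda>t. trunc_cover_time t x B) \<longlonglongrightarrow> cover_time x B" if "x \<in> S" "B \<subseteq> S" "x \<notin> B" for x B
    using trunc_cover_time_tendsto_cover_time[OF that(1) bound] that by blast
  have "l * harm k \<le> cover_time x (B - {y})" if "y \<in> B" for y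
  proof -
    have "card (B - {y}) = k" using that Suc.hyps(2) fin by simp
    then show ?thesis using Suc.hyps(1)[of "B - {y}"] Suc.prems by auto
  qed
  then have "real (Suc k) * (l * harm k) \<le> (\<Sum>y\<in>B. cover_time x (B - {y}))"
    using sum_bounded_below[of B "l * harm k" "\<lambda>y. cover_time x (B - {y})"] Suc.hyps(2) by simp
  moreover have "l \<le> real (card B) * cover_time x B - (\<Sum>y\<in>B. cover_time x (B - {y}))"
    by (rule tendsto_ge_of_miss_prob[OF _ bound excess_ge[OF lim low l]])
      (use Suc.prems ne in auto)
  ultimately have "real (Suc k) * (l * harm (Suc k)) \<le> real (Suc k) * cover_time x B"
    unfolding mult_harm_Suc by (simp add: Suc.hyps(2)[symmetric] algebra_simps)
  then show ?case using Suc.hyps(2) by simp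
qed

text \<open>A bounded nonnegative solution of the first-step equations is the expected hitting time.
  Stopping after \<open>t\<close> steps loses at most \<open>M\<close> on each path that has not yet
  hit \<open>y\<close>, hence the error \<open>M * miss_prob\<close>, which tends to 0.\<close>

lemma
  assumes y: "y \<in> S" and Gy: "G y = 0" and G0: "\<And>x. x \<in> S \<Longrightarrow> 0 \<le> G x"
    and GM: "\<And>x. x \<in> S \<Longrightarrow> G x \<le> M"
    and eq: "\<And>x. x \<in> S \<Longrightarrow> x \<noteq> y \<Longrightarrow> G x = 1 + (\<Sum>z\<in>S. pmf (K x) z * G z)"
    and x: "x \<in> S" "x \<noteq> y"
  shows trunc_cover_time_singleton_le: "trunc_cover_time t x {y} \<le> G x"
    and cover_time_singleton_ge: "G x \<le> cover_time x {y}"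
proof -
  have up: "trunc_cover_time t x {y} \<le> G x" if "x \<in> S" "x \<noteq> y" for t x
    using that
  proof (induction t arbitrary: x)
    case (Suc t)
    have "(\<Sum>z\<in>S. pmf (K x) z * trunc_cover_time t z ({y} - {z})) \<le> (\<Sum>z\<in>S. pmf (K x) z * G z)"
    proof (rule average_mono[OF Suc.prems(1)])
      fix z assume "z \<in> S"
      with Suc.IH G0 show "trunc_cover_time t z ({y} - {z}) \<le> G z" by (cases "z = y") auto
    qed
    then show ?case using eq Suc by (simp add: trunc_cover_time_Suc)
  qed (simp add: G0)
  then show "trunc_cover_time t x {y} \<le> G x" using x by blast
  have low: "G x - M * miss_prob t x {y} \<le> trunc_cover_time t x {y}" if "x \<in> S" "x \<noteq> y" for t x
    using that
  proof (induction t arbitrary: x)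
    case (Suc t)
    have "(\<Sum>z\<in>S. pmf (K x) z * (G z - M * miss_prob t z ({y} - {z})))
        \<le> (\<Sum>z\<in>S. pmf (K x) z * trunc_cover_time t z ({y} - {z}))"
    proof (rule average_mono[OF Suc.prems(1)])
      fix z assume "z \<in> S"
      with Suc.IH Gy show "G z - M * miss_prob t z ({y} - {z}) \<le> trunc_cover_time t z ({y} - {z})"
        by (cases "z = y") auto
    qed
    then show ?case using eq[of x] Suc
      by (simp add: trunc_cover_time_Suc miss_prob_Suc right_diff_distrib sum_subtractf
        sum_distrib_left mult.left_commute)
  qed (simp add: GM)
  show "G x \<le> cover_time x {y}"
    using tendsto_ge_of_miss_prob[OF x(1) up[OF x] low[OF x]
      trunc_cover_time_tendsto_cover_time[OF x(1) up[OF x]]] .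
qed

end

section \<open>The walk on \<open>r\<close>-subsets and its distance to a target\<close>

text \<open>The natural subtraction is never truncated: if \<open>x\<close> is not in
  \<open>Y\<close>, then \<open>H - Y\<close> contains \<open>x\<close>.\<close>

lemma card_swap_Diff:
  assumes "finite H" "x \<in> H" "z \<notin> H"
  shows "card (insert z (H - {x}) - Y)
    = card (H - Y) - (if x \<in> Y then 0 else 1) + (if z \<in> Y then 0 else 1)"
proof -
  have "insert z (H - {x}) - Y = (if z \<in> Y then H - Y - {x} else insert z (H - Y - {x}))"
    by auto
  moreover have "card (H - Y - {x}) = card (H - Y) - (if x \<in> Y then 0 else 1)"
    using assms by auto
  ultimately show ?thesis using assms by auto
qed

lemma finite_r_subsets: "finite (r_subsets n r)"
  by (rule finite_subset[of _ "Pow {1..n}"]) (auto simp: r_subsets_def)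

lemma card_r_subsets: "card (r_subsets n r) = n choose r"
  using n_subsets[of "{1..n}" r] by (simp add: r_subsets_def)

lemma r_subsets_nonempty: "r \<le> n \<Longrightarrow> r_subsets n r \<noteq> {}"
  using card_r_subsets[of n r] by (metis binomial_eq_0_iff card.empty not_le)

lemma r_subsetsD:
  assumes "H \<in> r_subsets n r"
  shows "H \<subseteq> {1..n}" "card H = r" "finite H" "card ({1..n} - H) = n - r"
proof -
  show *: "H \<subseteq> {1..n}" "card H = r" using assms by (auto simp: r_subsets_def)
  then show "finite H" using finite_subset by blast
  with * show "card ({1..n} - H) = n - r" by (simp add: card_Diff_subset)
qed

lemma set_pmf_rw_step:
  assumes "H \<in> r_subsets n r" "0 < r" "r < n"
  shows "set_pmf (rw_step n H) \<subseteq> r_subsets n r"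
proof -
  note H = r_subsetsD[OF assms(1)]
  have ne: "H \<noteq> {}" "{1..n} - H \<noteq> {}" using H assms by (auto simp del: Diff_eq_empty_iff)
  have "insert z (H - {x}) \<in> r_subsets n r" if "x \<in> H" "z \<in> {1..n} - H" for x z
    using that H assms(2) by (auto simp: r_subsets_def)
  then show ?thesis using ne H(3) by (auto simp: rw_step_def set_pmf_of_set)
qed

lemma rw_step_expectation:
  fixes f :: "nat set \<Rightarrow> real"
  assumes "H \<in> r_subsets n r" "0 < r" "r < n"
  shows "measure_pmf.expectation (rw_step n H) f
    = (\<Sum>x\<in>H. \<Sum>z\<in>{1..n} - H. f (insert z (H - {x}))) / (real r * (real n - real r))"
proof -
  note H = r_subsetsD[OF assms(1)]
  have ne: "H \<noteq> {}" "{1..n} - H \<noteq> {}" using H assms by (auto simp del: Diff_eq_empty_iff)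
  show ?thesis
    unfolding rw_step_def
    by (subst pmf_expectation_bind_pmf_of_set)
      (use ne H assms in \<open>simp_all add: integral_pmf_of_set sum_divide_distrib of_nat_diff
        set_pmf_of_set field_simps\<close>)
qed

text \<open>Count the pairs of a removed \<open>x\<close> and an inserted \<open>z\<close>. The
  distance drops for \<open>d * d\<close> pairs (\<open>x\<close> outside \<open>Y\<close>,
  \<open>z\<close> in \<open>Y\<close>) and grows for \<open>(r - d) * (n - r - d)\<close> pairs
  (\<open>x\<close> in \<open>Y\<close>, \<open>z\<close> outside \<open>Y\<close>). At
  \<open>d = 0\<close> the value at \<open>d - 1\<close> has coefficient 0.\<close>

lemma rw_step_distance:
  fixes \<phi> :: "nat \<Rightarrow> real"
  assumes H: "H \<in> r_subsets n r" and Y: "Y \<in> r_subsets n r" and r: "0 < r" "r < n"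
  defines "d \<equiv> card (H - Y)"
  shows "measure_pmf.expectation (rw_step n H) (\<lambda>A. \<phi> (card (A - Y)))
    = (real d ^ 2 * \<phi> (d - 1) + (real d * (real n - real r - real d) + (real r - real d) * real d) * \<phi> d
       + (real r - real d) * (real n - real r - real d) * \<phi> (Suc d)) / (real r * (real n - real r))"
    (is "_ = ?R / _")
proof -
  note H' = r_subsetsD[OF H] and Y' = r_subsetsD[OF Y]
  let ?C = "{1..n} - H"
  have c1: "card (H \<inter> Y) + d = r" unfolding d_def
    using card_Int_Diff[of H Y] H' by simp
  have "card (Y - H) + card (H \<inter> Y) = r"
    using card_Int_Diff[of Y H] Y' by (simp add: Int_commute)
  then have c2: "card (?C \<inter> Y) = d"
    using c1 Y' by (subgoal_tac "?C \<inter> Y = Y - H") auto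
  have c3: "card (?C - Y) + d = n - r"
    using card_Int_Diff[of ?C Y] H' c2 by simp
  have d0: "d \<noteq> 0" if "x \<in> H" "x \<notin> Y" for x
    using that H' by (auto simp: d_def)
  have "(\<Sum>x\<in>H. \<Sum>z\<in>?C. \<phi> (card (insert z (H - {x}) - Y)))
      = (\<Sum>x\<in>H. \<Sum>z\<in>?C. \<phi> (d - (if x \<in> Y then 0 else 1) + (if z \<in> Y then 0 else 1)))"
    using H' by (intro sum.cong refl) (simp add: card_swap_Diff d_def)
  also have "\<dots> = (\<Sum>x\<in>H. \<Sum>z\<in>?C. (if x \<in> Y then if z \<in> Y then \<phi> d else \<phi> (Suc d)
      else if z \<in> Y then \<phi> (d - 1) else \<phi> d))"
    using d0 by (intro sum.cong refl) auto
  also have "\<dots> = (\<Sum>x\<in>H. if x \<in> Y then real d * \<phi> d + real (card (?C - Y)) * \<phi> (Suc d)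
      else real d * \<phi> (d - 1) + real (card (?C - Y)) * \<phi> d)"
  proof (intro sum.cong refl)
    fix x assume "x \<in> H"
    have "(\<Sum>z\<in>?C. if z \<in> Y then a else b) = real d * a + real (card (?C - Y)) * b" for a b
      by (subst sum.Int_Diff[of ?C _ Y]) (simp_all add: c2 del: One_nat_def)
    then show "(\<Sum>z\<in>?C. (if x \<in> Y then if z \<in> Y then \<phi> d else \<phi> (Suc d)
      else if z \<in> Y then \<phi> (d - 1) else \<phi> d))
      = (if x \<in> Y then real d * \<phi> d + real (card (?C - Y)) * \<phi> (Suc d)
      else real d * \<phi> (d - 1) + real (card (?C - Y)) * \<phi> d)" by simp
  qed
  also have "\<dots> = real (card (H \<inter> Y)) * (real d * \<phi> d + real (card (?C - Y)) * \<phi> (Suc d))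
      + real d * (real d * \<phi> (d - 1) + real (card (?C - Y)) * \<phi> d)"
    by (subst sum.Int_Diff[of H _ Y]) (simp_all add: H' d_def)
  also have "real (card (H \<inter> Y)) = real r - real d" using c1 by simp
  also have "real (card (?C - Y)) = real n - real r - real d" using c3 r by (simp add: of_nat_diff)
  finally show ?thesis
    by (simp add: rw_step_expectation[OF H r] power2_eq_square algebra_simps)
qed

text \<open>The distance \<open>card (H - Y)\<close> to a target \<open>Y\<close> is a birth-death chain with reversible measure
  \<open>level_size\<close> and probability \<open>d\<^sup>2 / (r (n - r))\<close> of moving from \<open>d\<close> to \<open>d - 1\<close>; \<open>down_time\<close> is its
  expected passage time from \<open>d\<close> to \<open>d - 1\<close>.\<close>

definition level_size :: "nat \<Rightarrow> nat \<Rightarrow> nat \<Rightarrow> real" where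
  "level_size n r j = real (r choose j) * real ((n - r) choose j)"

definition down_time :: "nat \<Rightarrow> nat \<Rightarrow> nat \<Rightarrow> real" where
  "down_time n r d = (\<Sum>j=d..r. level_size n r j) * (real r * (real n - real r))
     / (level_size n r d * real d ^ 2)"

definition hit_time :: "nat \<Rightarrow> nat \<Rightarrow> nat \<Rightarrow> real" where
  "hit_time n r d = (\<Sum>j=1..d. down_time n r j)"

lemma level_size_nonneg: "level_size n r j \<ge> 0"
  by (simp add: level_size_def)

text \<open>The condition \<open>2 * r <= n\<close> makes every distance up to \<open>r\<close>
  occur.\<close>

lemma level_size_pos: "j \<le> r \<Longrightarrow> 2 * r \<le> n \<Longrightarrow> level_size n r j > 0"
  by (simp add: level_size_def zero_less_binomial_iff)

lemma down_time_nonneg: "r \<le> n \<Longrightarrow> down_time n r d \<ge> 0"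
  unfolding down_time_def
  by (intro divide_nonneg_nonneg mult_nonneg_nonneg sum_nonneg level_size_nonneg) auto

lemma sum_level_size:
  assumes "2 * r \<le> n"
  shows "(\<Sum>j=0..r. level_size n r j) = real (n choose r)"
proof -
  have "(\<Sum>j=0..r. level_size n r j) = real (\<Sum>j\<le>r. ((n - r) choose j) * (r choose (r - j)))"
    by (simp add: level_size_def atLeast0AtMost mult.commute flip: binomial_symmetric)
  also have "\<dots> = real (n choose r)" using assms by (subst vandermonde) simp
  finally show ?thesis .
qed

text \<open>Detailed balance between distances \<open>d\<close> and \<open>d + 1\<close>, with the
  common denominator \<open>r * (n - r)\<close> of the transition probabilities cleared.\<close>

lemma level_size_Suc:
  assumes "d \<le> r" "2 * r \<le> n"
  shows "level_size n r (Suc d) * real (Suc d) ^ 2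
    = level_size n r d * ((real r - real d) * (real n - real r - real d))"
proof -
  have *: "real (Suc d) * real (m choose Suc d) = (real m - real d) * real (m choose d)"
    if "d \<le> m" for m
    using binomial_absorb_comp[of m d] binomial_absorption[of d m] that
    by (metis of_nat_diff of_nat_mult)
  have "level_size n r (Suc d) * real (Suc d) ^ 2
      = (real (Suc d) * real (r choose Suc d)) * (real (Suc d) * real ((n - r) choose Suc d))"
    by (simp add: level_size_def power2_eq_square algebra_simps del: of_nat_Suc)
  also have "\<dots> = ((real r - real d) * real (r choose d))
      * ((real (n - r) - real d) * real ((n - r) choose d))"
    using assms by (subst (1 2) *) auto
  finally show ?thesis
    using assms by (simp add: level_size_def of_nat_diff)
qed

text \<open>First-step equation for the passage from \<open>d\<close> to \<open>d - 1\<close>.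
  Detailed balance gives both terms the denominator \<open>level_size n r d\<close>, so the two tail
  sums differ by that one level.\<close>

lemma down_time_rec:
  assumes "1 \<le> d" "d \<le> r" "2 * r \<le> n"
  shows "real d ^ 2 * down_time n r d
    - (real r - real d) * (real n - real r - real d) * down_time n r (Suc d)
    = real r * (real n - real r)"
proof -
  let ?c = "real r * (real n - real r)" and ?\<Sigma> = "\<lambda>d. \<Sum>j=d..r. level_size n r j"
  have pos: "level_size n r d > 0" using level_size_pos assms by blast
  have 1: "real d ^ 2 * down_time n r d = ?\<Sigma> d * ?c / level_size n r d"
    using assms by (simp add: down_time_def)
  have 2: "(real r - real d) * (real n - real r - real d) * down_time n r (Suc d)
      = ?\<Sigma> (Suc d) * ?c / level_size n r d"
  \<comment> \<open>For \<open>d = r\<close> the factor \<open>r - d\<close> is 0, so the value of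
    \<open>down_time\<close> beyond the largest distance does not matter.\<close>
  proof (cases "d = r")
    case False
    then have "real r - real d > 0" "real n - real r - real d > 0" using assms by auto
    then show ?thesis using pos
      by (simp add: down_time_def level_size_Suc[OF assms(2,3)] del: of_nat_Suc)
  qed simp
  have "?\<Sigma> d = level_size n r d + ?\<Sigma> (Suc d)"
    using assms by (simp add: sum.atLeast_Suc_atMost)
  then show ?thesis unfolding 1 2 using pos by (simp add: field_simps)
qed

text \<open>The levels from 1 on contain every subset except the target, and level 1 has exactly
  \<open>r * (n - r)\<close> members, which cancels the other factor.\<close>

lemma down_time_1:
  assumes "1 \<le> r" "2 * r \<le> n"
  shows "down_time n r 1 = real (n choose r) - 1"
proof -
  have "(\<Sum>j=1..r. level_size n r j) = real (n choose r) - 1"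
    using sum_level_size[OF assms(2)] by (simp add: sum.atLeast_Suc_atMost level_size_def)
  then show ?thesis using assms by (simp add: down_time_def level_size_def of_nat_diff)
qed

text \<open>The tail sum is at most the number of all subsets, while for \<open>d >= 2\<close> level
  \<open>d\<close> has size at least quadratic in \<open>n - r\<close>; one power of
  \<open>n - r\<close> is gained over the case \<open>d = 1\<close>.\<close>

lemma down_time_le:
  assumes "2 \<le> d" "d \<le> r" "2 * r \<le> n"
  shows "down_time n r d \<le> real (n choose r) * (real r ^ 3 / (real n - real r))"
proof -
  define m where "m = n - r"
  have m: "real n - real r = real m" "r \<le> m" "m > 0" using assms by (auto simp: m_def)
  have "(real m / real r) ^ 2 \<le> (real m / real d) ^ 2"
    using assms m by (intro power_mono divide_left_mono) auto
  also have "\<dots> \<le> (real m / real d) ^ d"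
    using assms m by (intro power_increasing) auto
  also have "\<dots> \<le> real (m choose d)"
    using binomial_ge_n_over_k_pow_k[of d m, where ?'a = real] assms m by simp
  also have "\<dots> \<le> level_size n r d"
    using mult_right_mono[of 1 "real (r choose d)" "real (m choose d)"] assms
    by (simp add: level_size_def m_def Suc_leI)
  also have "\<dots> \<le> level_size n r d * real d ^ 2"
    using level_size_nonneg[of n r d] assms by (simp add: mult_le_cancel_left1)
  finally have den: "(real m / real r) ^ 2 \<le> level_size n r d * real d ^ 2" .
  have num: "(\<Sum>j=d..r. level_size n r j) \<le> real (n choose r)"
    unfolding sum_level_size[OF assms(3), symmetric]
    by (intro sum_mono2) (auto simp: level_size_nonneg)
  have "down_time n r d \<le> real (n choose r) * (real r * real m) / (real m / real r) ^ 2"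
    unfolding down_time_def m(1)
    using assms m by (intro frac_le mult_right_mono num den mult_nonneg_nonneg) auto
  also have "\<dots> = real (n choose r) * (real r ^ 3 / real m)"
    using assms m by (simp add: field_simps power2_eq_square power3_eq_cube)
  finally show ?thesis by (simp add: m)
qed

text \<open>The passage from 1 to 0 contributes the main term; the fewer than \<open>r\<close>
  others contribute \<open>r ^ 3 / (n - r)\<close> each, relative to the number of subsets.\<close>

lemma hit_time_le:
  assumes "1 \<le> r" "2 * r \<le> n" "d \<le> r"
  shows "hit_time n r d \<le> real (n choose r) * (1 + real r ^ 4 / (real n - real r))"
proof -
  let ?b = "real (n choose r) * (real r ^ 3 / (real n - real r))"
  have b: "?b \<ge> 0" using assms by auto
  have "hit_time n r d \<le> hit_time n r r"
    unfolding hit_time_def using assms by (intro sum_mono2) (auto simp: down_time_nonneg)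
  also have "\<dots> = down_time n r 1 + (\<Sum>j=2..r. down_time n r j)"
    using assms by (simp add: hit_time_def sum.atLeast_Suc_atMost numeral_2_eq_2)
  also have "(\<Sum>j=2..r. down_time n r j) \<le> real (card {2..r}) * ?b"
    using assms by (intro sum_bounded_above down_time_le) auto
  also have "real (card {2..r}) * ?b \<le> real r * ?b"
    using b by (intro mult_right_mono) auto
  also have "down_time n r 1 \<le> real (n choose r)" using assms by (simp add: down_time_1[simplified])
  finally show ?thesis using assms
    by (simp add: algebra_simps power_numeral_reduce)
qed

lemma hit_time_ge:
  assumes "1 \<le> r" "2 * r \<le> n" "1 \<le> d"
  shows "real (n choose r) - 1 \<le> hit_time n r d"
proof -
  have "down_time n r 1 \<le> hit_time n r d"
    unfolding hit_time_def using assms by (intro member_le_sum) (auto simp: down_time_nonneg)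
  then show ?thesis using assms by (simp add: down_time_1[simplified])
qed

lemma hit_time_rec:
  assumes H: "H \<in> r_subsets n r" and Y: "Y \<in> r_subsets n r" and "H \<noteq> Y" and r: "1 \<le> r" "2 * r \<le> n"
  shows "hit_time n r (card (H - Y))
    = 1 + measure_pmf.expectation (rw_step n H) (\<lambda>A. hit_time n r (card (A - Y)))"
proof -
  note H' = r_subsetsD[OF H] and Y' = r_subsetsD[OF Y]
  define d where "d = card (H - Y)"
  have "H - Y \<noteq> {}"
    using H' Y' \<open>H \<noteq> Y\<close> by (metis Diff_eq_empty_iff card_subset_eq)
  then have d: "1 \<le> d" using H' by (simp add: d_def Suc_leI card_gt_0_iff)
  have dr: "d \<le> r" using card_mono[of H "H - Y"] H' by (auto simp: d_def)
  have g1: "hit_time n r (d - 1) = hit_time n r d - down_time n r d"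
    using d by (cases d) (auto simp: hit_time_def)
  have g2: "hit_time n r (Suc d) = hit_time n r d + down_time n r (Suc d)"
    by (simp add: hit_time_def)
  have pos: "real r * (real n - real r) \<noteq> 0" using r by auto
  have "measure_pmf.expectation (rw_step n H) (\<lambda>A. hit_time n r (card (A - Y)))
    = hit_time n r d - 1"
  proof -
    have "real d ^ 2 * (hit_time n r d - down_time n r d)
        + (real d * (real n - real r - real d) + (real r - real d) * real d) * hit_time n r d
        + (real r - real d) * (real n - real r - real d) * (hit_time n r d + down_time n r (Suc d))
      = (real r * (real n - real r)) * (hit_time n r d - 1)"
      using down_time_rec[OF d dr r(2)] by (simp add: algebra_simps power2_eq_square)
    moreover have "0 < r" "r < n" using r by auto
    ultimately show ?thesis
      unfolding rw_step_distance[OF H Y \<open>0 < r\<close> \<open>r < n\<close>] d_def[symmetric] g1 g2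
      using pos by simp
  qed
  then show ?thesis by (simp add: d_def)
qed

lemma finite_chain_rw:
  "1 \<le> r \<Longrightarrow> r < n \<Longrightarrow> finite_chain (rw_step n) (r_subsets n r)"
  by unfold_locales (use finite_r_subsets set_pmf_rw_step in auto)

lemma
  assumes "1 \<le> r" "2 * r \<le> n" and x: "x \<in> r_subsets n r" and y: "y \<in> r_subsets n r" and "x \<noteq> y"
  shows trunc_cover_time_rw_singleton_le: "finite_chain.trunc_cover_time (rw_step n) t x {y}
      \<le> real (n choose r) * (1 + real r ^ 4 / (real n - real r))" (is "?p \<le> ?h")
    and cover_time_rw_singleton_ge: "real (n choose r) - 1 \<le> finite_chain.cover_time (rw_step n) x {y}"
proof -
  interpret finite_chain "rw_step n" "r_subsets n r"
    using assms by (intro finite_chain_rw) auto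
  define G where "G z = hit_time n r (card (z - y))" for z
  have G: "G y = 0" by (simp add: G_def hit_time_def)
  have G0: "0 \<le> G z" for z
    using assms by (auto simp: G_def hit_time_def intro!: sum_nonneg down_time_nonneg)
  have Gh: "G z \<le> ?h" if "z \<in> r_subsets n r" for z
    unfolding G_def using assms card_mono[of z "z - y"] r_subsetsD[OF that]
    by (intro hit_time_le) auto
  have eq: "G z = 1 + (\<Sum>w\<in>r_subsets n r. pmf (rw_step n z) w * G w)"
    if "z \<in> r_subsets n r" "z \<noteq> y" for z
    using hit_time_rec[OF that(1) y that(2) assms(1,2)] that
    by (simp add: G_def expectation_eq_sum)
  note * = G G0 Gh eq
  show "?p \<le> ?h"
    using trunc_cover_time_singleton_le[OF y * x \<open>x \<noteq> y\<close>] Gh[OF x] by (rule order_trans)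
  have "x - y \<noteq> {}"
    using r_subsetsD[OF x] r_subsetsD[OF y] \<open>x \<noteq> y\<close> by (metis Diff_eq_empty_iff card_subset_eq)
  then have "real (n choose r) - 1 \<le> G x"
    unfolding G_def using assms r_subsetsD[OF x]
    by (intro hit_time_ge) (auto simp: Suc_le_eq card_gt_0_iff)
  then show "real (n choose r) - 1 \<le> cover_time x {y}"
    using cover_time_singleton_ge[OF y * x \<open>x \<noteq> y\<close>] by (rule order_trans)
qed

section \<open>From path distributions to miss probabilities\<close>

lemma set_pmf_rw_paths:
  assumes "1 \<le> r" "r < n"
  shows "finite (set_pmf (rw_paths n r k))"
    and "xs \<in> set_pmf (rw_paths n r (Suc k)) \<Longrightarrow> xs \<noteq> [] \<and> set xs \<subseteq> r_subsets n r"
proof -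
  have ne: "r_subsets n r \<noteq> {}" using r_subsets_nonempty assms by simp
  have *: "finite (set_pmf (rw_paths n r (Suc k)))
      \<and> (\<forall>xs\<in>set_pmf (rw_paths n r (Suc k)). xs \<noteq> [] \<and> set xs \<subseteq> r_subsets n r)" for k
  proof (induction k)
    case 0
    then show ?case using ne finite_r_subsets by (auto simp: set_pmf_of_set)
  next
    case (Suc k)
    have "set_pmf (rw_step n (last xs)) \<subseteq> r_subsets n r"
      if "xs \<in> set_pmf (rw_paths n r (Suc k))" for xs
    proof (rule set_pmf_rw_step)
      show "last xs \<in> r_subsets n r"
        using Suc.IH that last_in_set by blast
    qed (use assms in auto)
    then show ?case using Suc.IH
      by (auto intro: finite_subset[OF _ finite_r_subsets] dest: subsetD)
  qed
  show "finite (set_pmf (rw_paths n r k))" using * by (cases k) auto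
  show "xs \<in> set_pmf (rw_paths n r (Suc k)) \<Longrightarrow> xs \<noteq> [] \<and> set xs \<subseteq> r_subsets n r"
    using * by blast
qed

text \<open>\<open>rw_paths\<close> appends steps at the end, whereas \<open>miss_prob\<close>
  unfolds the first step. By the Markov property the last step of the path can be traded for one
  more unit of \<open>t\<close>, which is why the statement is general in \<open>t\<close>.\<close>

lemma rw_paths_miss_prob:
  assumes "1 \<le> r" "r < n"
  defines "S \<equiv> r_subsets n r" and "u \<equiv> finite_chain.miss_prob (rw_step n)"
  shows "measure_pmf.expectation (rw_paths n r (Suc k)) (\<lambda>xs. u t (last xs) (S - set xs))
    = measure_pmf.expectation (pmf_of_set S) (\<lambda>x. u (k + t) x (S - {x}))"
proof -
  interpret finite_chain "rw_step n" S
    unfolding S_def using assms(1,2) by (rule finite_chain_rw)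
  show ?thesis
  proof (induction k arbitrary: t)
    case 0
    then show ?case by (simp add: S_def)
  next
    case (Suc k)
    let ?A = "set_pmf (rw_paths n r (Suc k))"
    note paths = set_pmf_rw_paths[OF assms(1,2)]
    have last: "last xs \<in> S" if "xs \<in> ?A" for xs
      using paths(2)[OF that] last_in_set unfolding S_def by blast
    have fin: "finite (set_pmf (rw_step n (last xs)))" if "xs \<in> ?A" for xs
      using finite_subset[OF closed[OF last[OF that]] finite_S] .
    have "measure_pmf.expectation (rw_paths n r (Suc (Suc k))) (\<lambda>xs. u t (last xs) (S - set xs))
        = (\<Sum>xs\<in>?A. pmf (rw_paths n r (Suc k)) xs *
            measure_pmf.expectation (rw_step n (last xs)) (\<lambda>H. u t H (S - set xs - {H})))"
      unfolding rw_paths.simps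
      by (subst pmf_expectation_bind[of ?A])
        (use paths(1) fin in \<open>auto simp: Diff_insert[symmetric] intro!: sum.cong\<close>)
    also have "\<dots> = (\<Sum>xs\<in>?A. pmf (rw_paths n r (Suc k)) xs * u (Suc t) (last xs) (S - set xs))"
      by (simp add: u_def miss_prob.simps(2))
    also have "\<dots> = measure_pmf.expectation (rw_paths n r (Suc k))
        (\<lambda>xs. u (Suc t) (last xs) (S - set xs))"
      by (subst integral_measure_pmf[of ?A]) (use paths(1) in auto)
    also have "\<dots> = measure_pmf.expectation (pmf_of_set S) (\<lambda>x. u (Suc k + t) x (S - {x}))"
      by (simp add: Suc.IH)
    finally show ?case .
  qed
qed

text \<open>A list of length \<open>Suc k\<close> consists of the start and \<open>k\<close> steps.
  The start counts as visited here, so it is removed from the target set.\<close>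

lemma cover_prob_Suc:
  assumes "1 \<le> r" "r < n"
  defines "S \<equiv> r_subsets n r"
  shows "1 - cover_prob n r (Suc k)
    = (\<Sum>x\<in>S. finite_chain.miss_prob (rw_step n) k x (S - {x})) / real (n choose r)"
proof -
  interpret finite_chain "rw_step n" S
    unfolding S_def using assms(1,2) by (rule finite_chain_rw)
  have ne: "S \<noteq> {}" unfolding S_def using r_subsets_nonempty assms by simp
  have "1 - cover_prob n r (Suc k)
      = measure_pmf.prob (rw_paths n r (Suc k)) (- {xs. S \<subseteq> set xs})"
    unfolding cover_prob_def S_def
    by (subst measure_pmf.prob_compl[symmetric]) (simp_all add: Compl_eq_Diff_UNIV)
  also have "\<dots> = measure_pmf.expectation (rw_paths n r (Suc k))
      (indicator (- {xs. S \<subseteq> set xs}))"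
    by simp
  also have "indicator (- {xs. S \<subseteq> set xs}) = (\<lambda>xs. miss_prob 0 (last xs) (S - set xs))"
    by (auto simp: fun_eq_iff indicator_def)
  also have "measure_pmf.expectation (rw_paths n r (Suc k)) \<dots>
      = measure_pmf.expectation (pmf_of_set S) (\<lambda>x. miss_prob k x (S - {x}))"
    using rw_paths_miss_prob[OF assms(1,2), of k 0] by (simp add: S_def)
  also have "\<dots> = (\<Sum>x\<in>S. miss_prob k x (S - {x})) / real (n choose r)"
    by (simp add: integral_pmf_of_set ne finite_S) (simp add: S_def card_r_subsets)
  finally show ?thesis .
qed

section \<open>The expectation as a sum of tail probabilities, and its bounds\<close>

lemma suminf_ennreal_swap:
  fixes f :: "nat \<Rightarrow> nat \<Rightarrow> ennreal"
  shows "(\<Sum>k. \<Sum>j. f k j) = (\<Sum>j. \<Sum>k. f k j)"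
  using nn_integral_suminf[of "\<lambda>j k. f k j" "count_space UNIV"]
  by (simp add: nn_integral_count_space_nat)

text \<open>Write the factor \<open>k\<close> as a sum of ones over \<open>j < k\<close> and
  exchange the sums; for fixed \<open>j\<close> the differences telescope to \<open>a j\<close>. The
  term \<open>k = 0\<close>, where \<open>k - 1\<close> is truncated, has factor 0.\<close>

lemma suminf_tail:
  fixes a :: "nat \<Rightarrow> real"
  assumes dec: "\<And>k. a (Suc k) \<le> a k" and lim: "a \<longlonglongrightarrow> 0"
  shows "(\<Sum>k. of_nat k * ennreal (a (k - 1) - a k)) = (\<Sum>k. ennreal (a k))"
proof -
  define d where "d k = ennreal (a (k - 1) - a k)" for k
  have "(\<Sum>k. of_nat k * d k) = (\<Sum>k. \<Sum>j. if j < k then d k else 0)"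
  proof (rule suminf_cong)
    fix k
    show "of_nat k * d k = (\<Sum>j. if j < k then d k else 0)"
      by (subst suminf_finite[of "{..<k}"]) auto
  qed
  also have "\<dots> = (\<Sum>j. \<Sum>k. if j < k then d k else 0)"
    by (rule suminf_ennreal_swap)
  also have "\<dots> = (\<Sum>j. ennreal (a j))"
  proof (rule suminf_cong)
    fix j
    have "(\<lambda>i. a (i + j) - a (Suc i + j)) sums (a (0 + j) - 0)"
      by (rule telescope_sums'[of "\<lambda>i. a (i + j)"]) (rule LIMSEQ_ignore_initial_segment[OF lim])
    then have *: "(\<Sum>i. ennreal (a (i + j) - a (Suc i + j))) = ennreal (a j)"
      by (intro suminf_ennreal_eq) (use dec in auto)
    have "(\<Sum>k. if j < k then d k else 0)
        = (\<Sum>i. if j < i + Suc j then d (i + Suc j) else 0) + (\<Sum>k<Suc j. if j < k then d k else 0)"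
      by (rule suminf_offset) simp
    also have "(\<Sum>k<Suc j. if j < k then d k else 0) = 0"
      by (intro sum.neutral) auto
    finally show "(\<Sum>k. if j < k then d k else 0) = ennreal (a j)"
      using * by (simp add: d_def)
  qed
  finally show ?thesis unfolding d_def .
qed

lemma expected_cover_time_bounds:
  assumes r: "1 \<le> r" "2 * r \<le> n"
  defines "N \<equiv> n choose r"
  obtains E where "expected_cover_time n r = ennreal E"
    "(real N - 1) * ln (real N) \<le> E"
    "E \<le> 1 + real N * (1 + real r ^ 4 / (real n - real r)) * (1 + ln (real N))"
proof -
  have rn: "r < n" using r by auto
  define S where "S = r_subsets n r"
  interpret finite_chain "rw_step n" S
    unfolding S_def using r(1) rn by (rule finite_chain_rw)
  have N: "N > 0" using r by (simp add: N_def zero_less_binomial_iff)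
  have cardS: "card S = N" by (simp add: S_def N_def card_r_subsets)
  have cardS': "card (S - {x}) = N - 1" if "x \<in> S" for x using that cardS finite_S by simp
  define h where "h = real N * (1 + real r ^ 4 / (real n - real r))"
  have h: "0 \<le> h" unfolding h_def using r by auto
  have hit: "trunc_cover_time t x {y} \<le> h" "real N - 1 \<le> cover_time x {y}" if "x \<in> S" "y \<in> S" "x \<noteq> y" for t x y
    using trunc_cover_time_rw_singleton_le[OF r] cover_time_rw_singleton_ge[OF r] that
    by (auto simp: S_def h_def N_def)
  have up: "trunc_cover_time t x (S - {x}) \<le> h * harm (N - 1)" if "x \<in> S" for t x
    using matthews_upper[OF hit(1) h that, of "S - {x}" t] cardS'[OF that] by auto
  have low: "(real N - 1) * harm (N - 1) \<le> cover_time x (S - {x})" if "x \<in> S" for x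
    using matthews_lower[OF hit(1) h hit(2) _ that, of "S - {x}"] cardS'[OF that] N by auto
  have covle: "cover_time x (S - {x}) \<le> h * harm (N - 1)" if "x \<in> S" for x
    by (rule LIMSEQ_le_const2[OF trunc_cover_time_tendsto_cover_time[OF that up[OF that]]]) (use up that in auto)

  define a where "a k = 1 - cover_prob n r k" for k
  have a_Suc: "a (Suc k) = (\<Sum>x\<in>S. miss_prob k x (S - {x})) / real N" for k
    unfolding a_def S_def N_def by (rule cover_prob_Suc[OF r(1) rn])
  have "S \<noteq> {}" using cardS N by auto
  then have a_0: "a 0 = 1" by (simp add: a_def cover_prob_def S_def)
  have a_nonneg: "a k \<ge> 0" for k
    by (cases k) (auto simp: a_0 a_Suc miss_prob_nonneg intro!: divide_nonneg_nonneg sum_nonneg)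
  have dec: "a (Suc k) \<le> a k" for k
  proof (cases k)
    case 0
    have "a (Suc 0) \<le> 1" by (simp add: a_def cover_prob_def del: rw_paths.simps)
    then show ?thesis using 0 a_0 by simp
  next
    case (Suc j)
    then show ?thesis using N by (auto simp: a_Suc miss_prob_Suc_le intro!: divide_right_mono sum_mono)
  qed
  \<comment> \<open>The summand 1 is \<open>a 0\<close>: the initial state already occupies time
    1.\<close>
  define E where "E = (\<Sum>x\<in>S. cover_time x (S - {x})) / real N + 1"
  have "(\<lambda>k. miss_prob k x (S - {x})) sums cover_time x (S - {x})" if "x \<in> S" for x
    unfolding cover_time_def using summable_miss_prob[OF that up[OF that]] by (rule summable_sums)
  then have "(\<lambda>k. a (Suc k)) sums ((\<Sum>x\<in>S. cover_time x (S - {x})) / real N)"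
    unfolding a_Suc by (intro sums_divide sums_sum)
  then have sums: "a sums E"
    using sums_Suc[of a] a_0 by (simp add: E_def)
  have lim: "a \<longlonglongrightarrow> 0" using sums summable_LIMSEQ_zero sums_summable by blast
  have "cover_prob n r \<longlonglongrightarrow> 1 - 0"
    using tendsto_diff[OF tendsto_const[of 1] lim] by (simp add: a_def)
  moreover have "cover_prob n r \<longlonglongrightarrow> (SUP k. cover_prob n r k)"
  proof (rule LIMSEQ_incseq_SUP)
    show "bdd_above (range (cover_prob n r))"
      using a_nonneg by (intro bdd_aboveI[of _ 1]) (auto simp: a_def)
    show "incseq (cover_prob n r)"
      using dec by (intro incseq_SucI) (auto simp: a_def)
  qed
  \<comment> \<open>This rules out the infinite summand in
    \<open>expected_cover_time\<close>.\<close>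
  ultimately have "(SUP k. cover_prob n r k) = 1" using LIMSEQ_unique by fastforce
  moreover have "cover_prob n r k - cover_prob n r (k - 1) = a (k - 1) - a k" for k
    by (simp add: a_def)
  ultimately have "expected_cover_time n r = (\<Sum>k. ennreal (a k))"
    using suminf_tail[of a, OF dec lim] by (simp add: expected_cover_time_def)
  also have "\<dots> = ennreal E"
    using a_nonneg sums by (rule suminf_ennreal_eq)
  finally have "expected_cover_time n r = ennreal E" .
  moreover have "(real N - 1) * ln (real N) \<le> E"
  proof -
    have "(real N - 1) * ln (real N) \<le> (real N - 1) * harm (N - 1)"
      using ln_le_harm[of "N - 1"] N by (intro mult_left_mono) (auto simp: of_nat_diff)
    also have "\<dots> \<le> (\<Sum>x\<in>S. cover_time x (S - {x})) / real N"
    proof -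
      have "real N * ((real N - 1) * harm (N - 1)) \<le> (\<Sum>x\<in>S. cover_time x (S - {x}))"
        using low sum_bounded_below[of S "(real N - 1) * harm (N - 1)" "\<lambda>x. cover_time x (S - {x})"]
        unfolding cardS by blast
      then show ?thesis using N by (simp add: pos_le_divide_eq mult.commute)
    qed
    finally show ?thesis by (simp add: E_def)
  qed
  moreover have "E \<le> 1 + h * (1 + ln (real N))"
  proof -
    have "(\<Sum>x\<in>S. cover_time x (S - {x})) / real N \<le> h * harm (N - 1)"
    proof -
      have "(\<Sum>x\<in>S. cover_time x (S - {x})) \<le> real N * (h * harm (N - 1))"
        using covle sum_bounded_above[of S "\<lambda>x. cover_time x (S - {x})" "h * harm (N - 1)"]
        unfolding cardS by blast
      then show ?thesis using N by (simp add: pos_divide_le_eq mult.commute)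
    qed
    also have "\<dots> \<le> h * harm N"
      by (intro mult_left_mono harm_mono h) simp
    \<comment> \<open>The sequence \<open>harm N - ln N\<close> decreases from its value 1 at
      \<open>N = 1\<close>.\<close>
    also have "\<dots> \<le> h * (1 + ln (real N))"
      using euler_mascheroni_sequence_decreasing[of 1 N] h N
      by (intro mult_left_mono) (auto simp: harm_expand)
    finally show ?thesis by (simp add: E_def)
  qed
  ultimately show ?thesis using that by (simp add: h_def)
qed

section \<open>Asymptotics for fixed \<open>r\<close>\<close>

lemma filterlim_binomial_at_top:
  assumes "1 \<le> r"
  shows "filterlim (\<lambda>n. real (n choose r)) at_top at_top"
proof (rule filterlim_at_top_mono)
  show "filterlim (\<lambda>n. real n / real r) at_top at_top"
    using assms by real_asymp
  show "eventually (\<lambda>n. real n / real r \<le> real (n choose r)) at_top"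
    using eventually_ge_at_top[of r]
  proof eventually_elim
    case (elim n)
    have "real n / real r \<le> (real n / real r) ^ r"
      using elim assms by (intro self_le_power) auto
    also have "\<dots> \<le> real (n choose r)"
      using binomial_ge_n_over_k_pow_k[OF elim, where ?'a = real] by simp
    finally show ?case .
  qed
qed

theorem theorem4:
  fixes r :: nat
  assumes "r \<ge> 1"
  shows "(\<forall>\<^sub>F n in at_top. expected_cover_time n r < \<infinity>) \<and>
         (\<lambda>n. enn2real (expected_cover_time n r)) \<sim>[at_top]
         (\<lambda>n. real (n choose r) * ln (real (n choose r)))"
proof
  have large: "eventually (\<lambda>n. 2 * r \<le> n) at_top" by (rule eventually_ge_at_top)
  show "\<forall>\<^sub>F n in at_top. expected_cover_time n r < \<infinity>"
    using large
    by eventually_elim (metis expected_cover_time_bounds[OF assms] ennreal_less_top infinity_ennreal_def)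
  let ?N = "\<lambda>n. real (n choose r)"
  define l where "l n = (?N n - 1) * ln (?N n)" for n
  define u where "u n = 1 + ?N n * (1 + real r ^ 4 / (real n - real r)) * (1 + ln (?N n))" for n
  have N: "filterlim ?N at_top at_top" by (rule filterlim_binomial_at_top[OF assms])
  have ev: "eventually (\<lambda>n. ?N n > 1) at_top"
    using N unfolding filterlim_at_top_dense by blast
  have "(\<lambda>n. 1 - 1 / ?N n) \<longlonglongrightarrow> 1"
    by (rule filterlim_compose[OF _ N]) real_asymp
  then have "(\<lambda>n. l n / (?N n * ln (?N n))) \<longlonglongrightarrow> 1"
  proof (rule Lim_transform_eventually)
    show "eventually (\<lambda>n. 1 - 1 / ?N n = l n / (?N n * ln (?N n))) at_top"
      using ev
    proof eventually_elim
      case (elim n)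
      have nz: "?N n \<noteq> 0" "ln (?N n) \<noteq> 0"
        using elim ln_gt_zero[OF elim] by linarith+
      have "l n / (?N n * ln (?N n)) = (?N n - 1) / ?N n"
        unfolding l_def using nz(2) by (rule nonzero_mult_divide_mult_cancel_right)
      then show ?case by (simp only: diff_divide_distrib divide_self[OF nz(1)])
    qed
  qed
  then have l: "l \<sim>[at_top] (\<lambda>n. ?N n * ln (?N n))"
    by (rule asymp_equivI')
  have 1: "(\<lambda>n. 1 / (?N n * ln (?N n))) \<longlonglongrightarrow> 0"
    by (rule filterlim_compose[OF _ N]) real_asymp
  have 2: "(\<lambda>n. 1 + 1 / ln (?N n)) \<longlonglongrightarrow> 1"
    by (rule filterlim_compose[OF _ N]) real_asymp
  have 3: "(\<lambda>n. 1 + real r ^ 4 / (real n - real r)) \<longlonglongrightarrow> 1"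
    by real_asymp
  \<comment> \<open>\<open>v\<close> is the upper bound \<open>u\<close> divided by
    \<open>N * ln N\<close>, split into factors whose limits are known.\<close>
  define v where "v n = 1 / (?N n * ln (?N n))
    + (1 + real r ^ 4 / (real n - real r)) * (1 + 1 / ln (?N n))" for n
  have "v \<longlonglongrightarrow> 0 + 1 * 1"
    unfolding v_def by (intro tendsto_intros 1 2 3)
  then have v: "v \<longlonglongrightarrow> 1" by simp
  have "(\<lambda>n. u n / (?N n * ln (?N n))) \<longlonglongrightarrow> 1"
  proof (rule Lim_transform_eventually[OF v])
    show "eventually (\<lambda>n. v n = u n / (?N n * ln (?N n))) at_top"
      using ev
    proof eventually_elim
      case (elim n)
      then have "ln (?N n) > 0" by (rule ln_gt_zero)
      have *: "1 / (N * L) + c * (1 + 1 / L) = (1 + N * c * (1 + L)) / (N * L)"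
        if "N > 0" "L > 0" for N L c :: real
        using that by (simp add: field_simps)
      show ?case
        unfolding u_def v_def by (rule *) (use elim \<open>ln (?N n) > 0\<close> in linarith)+
    qed
  qed
  then have u: "u \<sim>[at_top] (\<lambda>n. ?N n * ln (?N n))"
    by (rule asymp_equivI')
  have sandwich: "eventually (\<lambda>n. enn2real (expected_cover_time n r) \<in> {l n..u n}) at_top"
    using large ev
  proof eventually_elim
    case (elim n)
    obtain E where E: "expected_cover_time n r = ennreal E" "l n \<le> E" "E \<le> u n"
      using expected_cover_time_bounds[OF assms elim(1)] unfolding l_def u_def by blast
    have "0 \<le> l n" using elim by (simp add: l_def)
    with E show ?case by simp
  qed
  show "(\<lambda>n. enn2real (expected_cover_time n r)) \<sim>[at_top] (\<lambda>n. ?N n * ln (?N n))"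
    using asymp_equiv_sandwich_real[OF l u sandwich] .
qed

end
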